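(* Assume $M\ge2$ is even. Fix $T>0$ and let $\{(X^{(0)}_t,X^{(1)}_t)\}_{t\in\mathbb{N}}$ denote the parallel tempering chain on the circle $\Omega=[0,1]$ defined in the context. Define the event $$\mathcal{S}=\Big\{\frac1{8M}\le X^{(0)}_T,\,X^{(1)}_T\le\frac3{8M}\Big\}$$ (assumed to have positive probability). Then for any $S>0$, $$\mathbb{E}\Big[\big(X^{(0)}_T-\pi_0[X_T^{(0)}]\big)\big(X^{(0)}_{T+S}-\pi_0[X_{T+S}^{(0)}]\big)\,\Big|\,\mathcal{S}\Big]\ \ge\ \frac1{32}-e^{-\frac{1}{1024M^2c^2S}},$$ where $\pi_0[X_T^{(0)}]=\pi_0[X_{T+S}^{(0)}]=\int_0^1x\,\pi(x)\,dx$ is the mean of the coordinate under $\pi_0=\pi$.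
   Context: $\Omega=[0,1]$ with $0$ and $1$ identified (points are given by their coordinate in $[0,1)$), with metric $d(x,y)=\min(|x-y|,1-|x-y|)$; $\lambda$ is Lebesgue measure. $H\ge0$, $0<c<\frac1{4M}$, $0<p_{ee}<1$. The target $\pi_0=\pi$ has density $\pi(x)=\frac{2}{1+e^H}$ for $0\le x\le\frac1{2M}$, $\pi(x)=\frac{2e^H}{1+e^H}$ for $\frac1{2M}<x<\frac1M$, extended with period $\frac1M$; the potential $V$ equals $H$ where the density is $\frac2{1+e^H}$ and $0$ elsewhere. $\pi_1=\lambda$. The proposal kernel is $K_{\mathrm{MH}}(x,A)=\frac1{2c}\lambda(A\cap\{y:d(x,y)<c\})$. Parallel tempering with two temperatures (inverse temperatures $\beta_0=1$, $\beta_1=0$): at each time $t$, with probability $1-p_{ee}$ both coordinates are updated independently, $X^{(i)}$ by one Metropolis-Hastings step with proposal $K_{\mathrm{MH}}$ and target $\pi_i$, $i\in\{0,1\}$; with probability $p_{ee}$ a swap $(X^{(0)}_{t+1},X^{(1)}_{t+1})=(X^{(1)}_t,X^{(0)}_t)$ is made with probability $\min\big(1,e^{(V(X^{(0)}_t)-V(X^{(1)}_t))(\beta_0-\beta_1)}\big)$, and otherwise both coordinates stay unchanged. $T,S$ are integers; the initial conditions are arbitrary. *)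

theory Defs
  imports "HOL-Probability.Probability"
begin

text \<open>The circle of circumference 1; a point is represented by its coordinate in \<open>[0,1)\<close>.\<close>

definition circle :: "real measure" where
  "circle = restrict_space lborel {0..<1}"

definition circ_dist :: "real \<Rightarrow> real \<Rightarrow> real" where
  "circ_dist x y = min \<bar>x - y\<bar> (1 - \<bar>x - y\<bar>)"

text \<open>Here \<open>frac (M x) / M\<close> is the representative of \<open>x\<close> modulo \<open>1/M\<close> in \<open>[0,1/M)\<close>.\<close>

definition target_density :: "nat \<Rightarrow> real \<Rightarrow> real \<Rightarrow> real" where
  "target_density M H x =
     (if frac (real M * x) / real M \<le> 1 / (2 * real M)
      then 2 / (1 + exp H) else 2 * exp H / (1 + exp H))"

definition potential :: "nat \<Rightarrow> real \<Rightarrow> real \<Rightarrow> real" where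
  "potential M H x = (if target_density M H x = 2 / (1 + exp H) then H else 0)"

definition target_mean :: "nat \<Rightarrow> real \<Rightarrow> real" where
  "target_mean M H = (LBINT x:{0..1}. x * target_density M H x)"

definition proposal_density :: "real \<Rightarrow> real \<Rightarrow> real \<Rightarrow> real" where
  "proposal_density c x y = (if circ_dist x y < c then 1 / (2 * c) else 0)"

text \<open>
  Metropolis-Hastings kernel on the circle with proposal density \<open>q\<close> and target density \<open>p\<close>,
  both with respect to Lebesgue measure. Division by zero in the Hastings ratio only occurs
  at proposals \<open>y\<close> of probability zero, provided that \<open>p\<close> is positive.
\<close>

definition mh_acceptance :: "(real \<Rightarrow> real \<Rightarrow> real) \<Rightarrow> (real \<Rightarrow> real) \<Rightarrow> real \<Rightarrow> real \<Rightarrow> real" where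
  "mh_acceptance q p x y = min 1 ((p y * q y x) / (p x * q x y))"

definition mh_kernel :: "(real \<Rightarrow> real \<Rightarrow> real) \<Rightarrow> (real \<Rightarrow> real) \<Rightarrow> real \<Rightarrow> real measure" where
  "mh_kernel q p x =
     density circle (\<lambda>y. ennreal (q x y)) \<bind> (\<lambda>y.
     measure_pmf (bernoulli_pmf (mh_acceptance q p x y)) \<bind> (\<lambda>accept.
     return circle (if accept then y else x)))"

definition swap_probability :: "nat \<Rightarrow> real \<Rightarrow> real \<Rightarrow> real \<Rightarrow> real \<Rightarrow> real \<Rightarrow> real" where
  "swap_probability M H \<beta>0 \<beta>1 x0 x1 =
     min 1 (exp ((potential M H x0 - potential M H x1) * (\<beta>0 - \<beta>1)))"

text \<open>
  One step of parallel tempering with inverse temperatures \<open>\<beta>0 = 1\<close> (target \<open>target_density\<close>)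
  and \<open>\<beta>1 = 0\<close> (target Lebesgue measure, i.e. constant density 1).
\<close>

definition pt_kernel ::
  "nat \<Rightarrow> real \<Rightarrow> real \<Rightarrow> real \<Rightarrow> real \<times> real \<Rightarrow> (real \<times> real) measure" where
  "pt_kernel M H c p_ee x =
     measure_pmf (bernoulli_pmf p_ee) \<bind> (\<lambda>exchange.
     if exchange then
       measure_pmf (bernoulli_pmf (swap_probability M H 1 0 (fst x) (snd x))) \<bind> (\<lambda>swap.
       return (circle \<Otimes>\<^sub>M circle) (if swap then (snd x, fst x) else x))
     else
       mh_kernel (proposal_density c) (target_density M H) (fst x) \<Otimes>\<^sub>M
       mh_kernel (proposal_density c) (\<lambda>_. 1) (snd x))"

text \<open>
  A time-homogeneous Markov chain with state space \<open>S\<close>, transition kernel \<open>K\<close> and arbitrary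
  initial distribution; the Markov property refers to the natural filtration.
\<close>

definition natural_filtration ::
  "'a measure \<Rightarrow> 'b measure \<Rightarrow> (nat \<Rightarrow> 'a \<Rightarrow> 'b) \<Rightarrow> nat \<Rightarrow> 'a measure" where
  "natural_filtration P S X t = sigma (space P) {X s -` A \<inter> space P | s A. s \<le> t \<and> A \<in> sets S}"

definition markov_chain ::
  "'a measure \<Rightarrow> 'b measure \<Rightarrow> ('b \<Rightarrow> 'b measure) \<Rightarrow> (nat \<Rightarrow> 'a \<Rightarrow> 'b) \<Rightarrow> bool" where
  "markov_chain P S K X \<longleftrightarrow>
     prob_space P \<and>
     K \<in> S \<rightarrow>\<^sub>M prob_algebra S \<and>
     (\<forall>t. X t \<in> P \<rightarrow>\<^sub>M S) \<and>
     (\<forall>t. \<forall>A\<in>sets S. AE \<omega> in P.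
        real_cond_exp P (natural_filtration P S X t) (\<lambda>\<omega>'. indicator A (X (Suc t) \<omega>')) \<omega>
          = measure (K (X t \<omega>)) A)"

text \<open>The transition kernel above is indeed a probability kernel, so the kernel condition in
  \<open>markov_chain\<close> imposes no restriction beyond \<open>0 < c < 1/2\<close>.\<close>

lemma space_circle [simp]: "space circle = {0..<1}"
  by (simp add: circle_def space_restrict_space)

lemma measurable_target_density [measurable]: "target_density M H \<in> borel_measurable borel"
  unfolding target_density_def[abs_def] frac_def by measurable

lemma measurable_potential [measurable]: "potential M H \<in> borel_measurable borel"
  unfolding potential_def[abs_def] by measurable

lemma measurable_proposal_density [measurable (raw)]:
  assumes [measurable]: "f \<in> borel_measurable N" "g \<in> borel_measurable N"
  shows "(\<lambda>z. proposal_density c (f z) (g z)) \<in> borel_measurable N"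
  unfolding proposal_density_def circ_dist_def by measurable

lemma emeasure_circ_ball:
  assumes x: "0 \<le> x" "x < 1" and c: "0 < c" "c < 1/2"
  shows "emeasure lborel {y \<in> {0..<1}. circ_dist x y < c} = ennreal (2 * c)"
proof -
  consider "x < c" | "c \<le> x" "x \<le> 1 - c" | "1 - c < x" by linarith
  then show ?thesis
  proof cases
    case 1
    have eq: "{y \<in> {0..<1}. circ_dist x y < c} = {0..<x + c} \<union> {x + 1 - c<..<1}"
      using 1 x c by (auto simp: circ_dist_def min_def abs_if split: if_splits)
    show ?thesis unfolding eq
      by (subst plus_emeasure[symmetric]) (use 1 x c in \<open>auto simp flip: ennreal_plus\<close>)
  next
    case 2
    have eq: "{y \<in> {0..<1}. circ_dist x y < c} = {x - c<..<x + c}"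
      using 2 x c by (auto simp: circ_dist_def min_def abs_if split: if_splits)
    show ?thesis unfolding eq using c by auto
  next
    case 3
    have eq: "{y \<in> {0..<1}. circ_dist x y < c} = {0..<x - 1 + c} \<union> {x - c<..<1}"
      using 3 x c by (auto simp: circ_dist_def min_def abs_if split: if_splits)
    show ?thesis unfolding eq
      by (subst plus_emeasure[symmetric]) (use 3 x c in \<open>auto simp flip: ennreal_plus\<close>)
  qed
qed

lemma prob_space_proposal:
  assumes x: "x \<in> {0..<1}" and c: "0 < c" "c < 1/2"
  shows "prob_space (density circle (\<lambda>y. ennreal (proposal_density c x y)))"
proof
  have [measurable]: "(\<lambda>y. ennreal (proposal_density c x y)) \<in> borel_measurable circle"
    unfolding circle_def by (intro measurable_restrict_space1) measurable
  have "emeasure (density circle (\<lambda>y. ennreal (proposal_density c x y))) {0..<1}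
      = (\<integral>\<^sup>+y. ennreal (proposal_density c x y) * indicator {0..<1} y \<partial>circle)"
    by (subst emeasure_density) (auto simp: circle_def[THEN arg_cong[where f=sets]] sets_restrict_space_iff)
  also have "\<dots> = (\<integral>\<^sup>+y. ennreal (proposal_density c x y) * indicator {0..<1} y \<partial>lborel)"
    unfolding circle_def
    by (subst nn_integral_restrict_space)
       (auto intro!: nn_integral_cong split: split_indicator)
  also have "\<dots> = (\<integral>\<^sup>+y. ennreal (1 / (2 * c)) *
      indicator {y \<in> {0..<1}. circ_dist x y < c} y \<partial>lborel)"
    by (intro nn_integral_cong) (auto simp: proposal_density_def split: split_indicator)
  also have "\<dots> = ennreal (1 / (2 * c)) * emeasure lborel {y \<in> {0..<1}. circ_dist x y < c}"
    by (rule nn_integral_cmult_indicator) (simp add: circ_dist_def)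
  also have "\<dots> = ennreal (1 / (2 * c)) * ennreal (2 * c)"
    using x c emeasure_circ_ball[of x c] by simp
  also have "\<dots> = ennreal (1 / (2 * c) * (2 * c))"
    using c by (intro ennreal_mult[symmetric]) auto
  also have "\<dots> = 1"
    using c by simp
  finally show "emeasure (density circle (\<lambda>y. ennreal (proposal_density c x y)))
      (space (density circle (\<lambda>y. ennreal (proposal_density c x y)))) = 1"
    by simp
qed

lemma measurable_bernoulli_pmf:
  assumes [measurable]: "f \<in> borel_measurable N"
  shows "(\<lambda>z. measure_pmf (bernoulli_pmf (f z))) \<in> N \<rightarrow>\<^sub>M prob_algebra (count_space UNIV)"
proof (rule measurable_prob_algebraI)
  show "(\<lambda>z. measure_pmf (bernoulli_pmf (f z))) \<in> N \<rightarrow>\<^sub>M subprob_algebra (count_space UNIV)"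
  proof (rule measurable_subprob_algebra)
    fix A :: "bool set"
    have "emeasure (measure_pmf (bernoulli_pmf (f z))) A
        = (\<Sum>b\<in>A. ennreal (if b then min 1 (max 0 (f z)) else 1 - min 1 (max 0 (f z))))" for z
      by (subst emeasure_measure_pmf_finite)
         (auto intro!: sum.cong simp: bernoulli_pmf.rep_eq max.commute min_def max_def)
    then show "(\<lambda>z. emeasure (measure_pmf (bernoulli_pmf (f z))) A) \<in> borel_measurable N"
      by (simp cong del: if_weak_cong)
  qed (auto intro: prob_space_imp_subprob_space measure_pmf.prob_space_axioms)
qed (rule measure_pmf.prob_space_axioms)

lemma measurable_id_circle: "(\<lambda>x. x) \<in> borel_measurable circle"
  unfolding circle_def by (intro measurable_restrict_space1) simp

lemma sigma_finite_circle: "sigma_finite_measure circle"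
  unfolding circle_def by (intro sigma_finite_measure_restrict_space sigma_finite_lborel) simp

lemma measurable_proposal:
  assumes c: "0 < c" "c < 1/2"
  shows "(\<lambda>x. density circle (\<lambda>y. ennreal (proposal_density c x y)))
    \<in> circle \<rightarrow>\<^sub>M prob_algebra circle"
proof (rule measurable_prob_algebraI)
  note measurable_id_circle[measurable]
  interpret sigma_finite_measure circle by (rule sigma_finite_circle)
  show "(\<lambda>x. density circle (\<lambda>y. ennreal (proposal_density c x y)))
    \<in> circle \<rightarrow>\<^sub>M subprob_algebra circle"
  proof (rule measurable_subprob_algebra)
    fix A assume [measurable]: "A \<in> sets circle"
    have "(\<lambda>x. \<integral>\<^sup>+y. ennreal (proposal_density c x y) * indicator A y \<partial>circle)
        \<in> borel_measurable circle"
      by measurable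
    then show "(\<lambda>x. emeasure (density circle (\<lambda>y. ennreal (proposal_density c x y))) A)
        \<in> borel_measurable circle"
      by (simp add: emeasure_density)
  qed (use c in \<open>auto intro!: prob_space_imp_subprob_space prob_space_proposal\<close>)
qed (use c in \<open>auto intro!: prob_space_proposal\<close>)

lemma measurable_mh_kernel:
  assumes [measurable]: "p \<in> borel_measurable borel" and c: "0 < c" "c < 1/2"
  shows "mh_kernel (proposal_density c) p \<in> circle \<rightarrow>\<^sub>M prob_algebra circle"
proof -
  note measurable_id_circle[measurable] measurable_proposal[OF c, measurable] measurable_bernoulli_pmf[measurable (raw)]
  show ?thesis
    unfolding mh_kernel_def[abs_def] mh_acceptance_def by measurable
qed

lemma measurable_pt_kernel:
  assumes c: "0 < c" "c < 1/2"
  shows "pt_kernel M H c p_ee \<in> circle \<Otimes>\<^sub>M circle \<rightarrow>\<^sub>M prob_algebra (circle \<Otimes>\<^sub>M circle)"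
proof -
  have [measurable]: "mh_kernel (proposal_density c) (target_density M H) \<in> circle \<rightarrow>\<^sub>M prob_algebra circle"
    "mh_kernel (proposal_density c) (\<lambda>_. 1) \<in> circle \<rightarrow>\<^sub>M prob_algebra circle"
    by (auto intro!: measurable_mh_kernel c)
  note measurable_id_circle[measurable] measurable_bernoulli_pmf[measurable (raw)]
  show ?thesis
    unfolding pt_kernel_def[abs_def] swap_probability_def by measurable
qed

end

theory Submission
  imports Defs
begin

text \<open>
  Put \<open>L = 1/(8M)\<close>, so that the event \<open>E\<close> says that both coordinates lie in \<open>[L, 3L]\<close>, the middle half of
  the low-density cell \<open>[0, 4L]\<close>. The function \<open>min 1 (b x\<^sub>0 + b x\<^sub>1)\<close>, where \<open>b\<close> is the squared distance
  to \<open>[L, 3L]\<close> in units of \<open>L\<close> truncated at 1, vanishes on \<open>E\<close>, equals 1 outside the cell and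
  grows in expectation by at most \<open>2 c\<^sup>2 / (3 L\<^sup>2)\<close> per step: it is invariant under swaps, and from inside
  the cell every Metropolis-Hastings move is accepted, since both targets are minimal there.
  Hence, given \<open>E\<close>, the first coordinate has left the cell at time \<open>T + S\<close> with probability at most
  \<open>128/3 M\<^sup>2 c\<^sup>2 S\<close>. The mean of the target lies in \<open>[1/2, 1/2 + 2L]\<close>, so the product of deviations is
  at least \<open>5/64\<close> inside the cell and at least \<open>-9/32\<close> anywhere. This linear bound suffices because
  the claim is trivial unless \<open>M\<^sup>2 c\<^sup>2 S\<close> is small.
\<close>

section \<open>Metropolis-Hastings moves that are always accepted\<close>

text \<open>The proposal density is symmetric, so the Hastings ratio is \<open>p y / p x\<close>,
  which is at least 1 on the whole proposal ball. Nothing is rejected, and the kernel integrates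
  like its proposal. The result is stated over \<open>lborel\<close> so that explicit
  antiderivatives apply.\<close>

lemma nn_integral_mh_kernel_uphill:
  assumes [measurable]: "p \<in> borel_measurable borel" "f \<in> borel_measurable circle"
    and c: "0 < c" "c < 1/2" and x: "x \<in> {0..<1}" and "0 < p x"
    and uphill: "\<And>y. y \<in> {0..<1} \<Longrightarrow> circ_dist x y < c \<Longrightarrow> p x \<le> p y"
  shows "(\<integral>\<^sup>+y. f y \<partial>mh_kernel (proposal_density c) p x)
       = (\<integral>\<^sup>+y. ennreal (proposal_density c x y) * f y * indicator {0..<1} y \<partial>lborel)"
proof -
  note measurable_id_circle[measurable] measurable_bernoulli_pmf[measurable (raw)]
  let ?q = "proposal_density c" and ?D = "density circle (\<lambda>y. ennreal (proposal_density c x y))"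
  let ?r = "\<lambda>y. \<lambda>accept. return circle (if accept then y else x)"
  let ?N = "\<lambda>y. measure_pmf (bernoulli_pmf (mh_acceptance ?q p x y)) \<bind> ?r y"
  have x': "x \<in> space circle"
    using x by simp
  have "?N \<in> circle \<rightarrow>\<^sub>M prob_algebra circle"
    unfolding mh_acceptance_def using x' by measurable
  then have N: "?N \<in> ?D \<rightarrow>\<^sub>M subprob_algebra circle"
    by (simp add: measurable_prob_algebraD)
  have r: "?r y \<in> measure_pmf b \<rightarrow>\<^sub>M subprob_algebra circle" if "y \<in> space circle" for y b
    using that x' by (auto simp: space_subprob_algebra
        intro!: prob_space_imp_subprob_space prob_space_return)
  have "(\<integral>\<^sup>+y. f y \<partial>mh_kernel ?q p x) = (\<integral>\<^sup>+y. (\<integral>\<^sup>+z. f z \<partial>?N y) \<partial>?D)"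
    unfolding mh_kernel_def by (rule nn_integral_bind[OF _ N]) measurable
  also have "\<dots> = (\<integral>\<^sup>+y. ennreal (?q x y) * (\<integral>\<^sup>+z. f z \<partial>?N y) \<partial>circle)"
    using N by (intro nn_integral_density) auto
  also have "\<dots> = (\<integral>\<^sup>+y. ennreal (?q x y) * f y \<partial>circle)"
  proof (rule nn_integral_cong)
    fix y assume y: "y \<in> space circle"
    show "ennreal (?q x y) * (\<integral>\<^sup>+z. f z \<partial>?N y) = ennreal (?q x y) * f y"
    proof (cases "circ_dist x y < c")
      case True
      then have "?q y x = ?q x y" "?q x y > 0"
        using c by (auto simp: proposal_density_def circ_dist_def abs_minus_commute)
      then have "mh_acceptance ?q p x y = 1"
        using uphill[OF _ True] y \<open>0 < p x\<close> by (auto simp: mh_acceptance_def)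
      then have "(\<integral>\<^sup>+z. f z \<partial>?N y) = f y"
        using y by (subst nn_integral_bind[OF _ r]) (auto simp: nn_integral_return)
      then show ?thesis by simp
    \<comment> \<open>Off the proposal ball both sides carry the factor 0, whatever the acceptance
      probability is.\<close>
    qed (simp add: proposal_density_def)
  qed
  also have "\<dots> = (\<integral>\<^sup>+y. ennreal (?q x y) * f y * indicator {0..<1} y \<partial>lborel)"
    unfolding circle_def by (subst nn_integral_restrict_space) (auto simp: mult.assoc)
  finally show ?thesis .
qed

section \<open>The barrier function and its growth under one proposal\<close>

text \<open>For \<open>0 < L\<close> this is the signed distance to \<open>[L, 3L]\<close> along the
  line, not around the circle. The truncated square is still continuous at the identified point when
  \<open>4 * L \<le> 1\<close>, being 1 at both 0 and 1.\<close>

definition excess :: "real \<Rightarrow> real \<Rightarrow> real" where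
  "excess L x = x - max L (min (3 * L) x)"

definition barrier :: "real \<Rightarrow> real \<Rightarrow> real" where
  "barrier L x = min 1 ((excess L x / L)\<^sup>2)"

text \<open>The outer truncation makes the drift bound trivial once the sum reaches 1. A sum below 1
  puts both coordinates inside the cell, where moves are accepted.\<close>

definition pair_barrier :: "real \<Rightarrow> real \<times> real \<Rightarrow> real" where
  "pair_barrier L z = min 1 (barrier L (fst z) + barrier L (snd z))"

lemma measurable_barrier [measurable]: "barrier L \<in> borel_measurable borel"
  unfolding barrier_def[abs_def] excess_def by measurable

lemma barrier_nonneg: "0 \<le> barrier L x"
  by (simp add: barrier_def)

lemma barrier_le_1: "barrier L x \<le> 1"
  by (simp add: barrier_def)

lemma barrier_eq_0: "x \<in> {L..3 * L} \<Longrightarrow> barrier L x = 0"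
  by (simp add: barrier_def excess_def)

lemma barrier_less_1D:
  assumes "0 < L" "barrier L x < 1"
  shows "0 < x" "x < 4 * L"
proof -
  have "(excess L x / L)\<^sup>2 < 1"
    using assms by (auto simp: barrier_def)
  then have "\<bar>excess L x\<bar> < L"
    using assms by (simp add: abs_square_less_1)
  then show "0 < x" "x < 4 * L"
    using assms by (auto simp: excess_def max_def min_def split: if_splits)
qed

text \<open>The projection of \<open>x\<close> onto \<open>[L, 3L]\<close> is a candidate for the point nearest to \<open>y\<close>. This
  gives a quadratic upper bound in \<open>y\<close> that is exact at \<open>y = x\<close> as long as \<open>barrier L x < 1\<close>.\<close>

lemma barrier_le_quadratic:
  assumes "0 < L"
  shows "barrier L y \<le> ((y - max L (min (3 * L) x)) / L)\<^sup>2"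
proof -
  have "\<bar>excess L y\<bar> \<le> \<bar>y - max L (min (3 * L) x)\<bar>"
    using assms by (auto simp: excess_def)
  then have "(excess L y / L)\<^sup>2 \<le> ((y - max L (min (3 * L) x)) / L)\<^sup>2"
    unfolding power_divide by (intro divide_right_mono) (auto simp: abs_le_square_iff)
  then show ?thesis
    by (simp add: barrier_def)
qed

lemma nn_integral_scaled_square:
  fixes a l u L c :: real
  assumes "l \<le> u" "0 < L" "0 < c"
  shows "(\<integral>\<^sup>+y. ennreal (1 / (2 * c) * ((y - a) / L)\<^sup>2) * indicator {l..u} y \<partial>lborel)
       = ennreal (((u - a) ^ 3 - (l - a) ^ 3) / (6 * c * L\<^sup>2))"
proof -
  have "((\<lambda>y. (y - a) ^ 3 / (6 * c * L\<^sup>2)) has_real_derivative 1 / (2 * c) * ((y - a) / L)\<^sup>2) (at y)" for y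
    using assms by (auto intro!: derivative_eq_intros simp: field_simps power2_eq_square)
  then show ?thesis
    using assms by (subst nn_integral_FTC_Icc[where F="\<lambda>y. (y - a) ^ 3 / (6 * c * L\<^sup>2)"])
      (auto intro!: derivative_eq_intros simp: diff_divide_distrib)
qed

text \<open>A uniform variable on \<open>(x - c, x + c)\<close> has variance
  \<open>c\<^sup>2 / 3\<close>, so its mean squared distance to the fixed point \<open>a\<close>
  exceeds \<open>(x - a)\<^sup>2\<close> by exactly that amount. The quadratic around
  \<open>a\<close> dominates the barrier, and division by \<open>L\<^sup>2\<close> gives the
  increment.\<close>

lemma nn_integral_proposal_barrier:
  assumes L: "0 < L" "6 * L < 1" and c: "0 < c" "c \<le> 2 * L" and lt1: "barrier L x < 1"
  shows "(\<integral>\<^sup>+y. ennreal (proposal_density c x y) * ennreal (barrier L y) * indicator {0..<1} y \<partial>lborel)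
       \<le> ennreal (barrier L x + c\<^sup>2 / (3 * L\<^sup>2))" (is "?I \<le> _")
proof -
  define a where "a = max L (min (3 * L) x)"
  define g where "g y = 1 / (2 * c) * ((y - a) / L)\<^sup>2" for y
  have [measurable]: "g \<in> borel_measurable borel"
    unfolding g_def by measurable
  have g: "1 / (2 * c) * barrier L y \<le> g y" for y
    unfolding g_def a_def using c L by (intro mult_left_mono barrier_le_quadratic) auto
  have x: "0 < x" "x < 4 * L"
    using barrier_less_1D[OF L(1) lt1] by auto
  have bx: "barrier L x = ((x - a) / L)\<^sup>2"
    using lt1 by (auto simp: barrier_def excess_def a_def)
  \<comment> \<open>The bound is the integral of \<open>g\<close> over the unwrapped interval
    \<open>[x - c, x + c]\<close>, even when the proposal wraps around.\<close>
  have "?I \<le> ennreal (((x + c - a) ^ 3 - (x - c - a) ^ 3) / (6 * c * L\<^sup>2))"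
  proof (cases "c \<le> x")
    case True
    \<comment> \<open>No wrapping occurs here: \<open>c \<le> x\<close> excludes it at 0, and
      \<open>x + c < 6 * L < 1\<close> excludes it at 1.\<close>
    have "?I \<le> (\<integral>\<^sup>+y. ennreal (g y) * indicator {x - c..x + c} y \<partial>lborel)"
    proof (rule nn_integral_mono)
      fix y :: real
      show "ennreal (proposal_density c x y) * ennreal (barrier L y) * indicator {0..<1} y
        \<le> ennreal (g y) * indicator {x - c..x + c} y"
        using True x L c g[of y]
        by (auto simp: proposal_density_def circ_dist_def barrier_nonneg min_def abs_if
            simp flip: ennreal_mult intro!: ennreal_leI split: split_indicator if_splits)
    qed
    also have "\<dots> = ennreal (((x + c - a) ^ 3 - (x - c - a) ^ 3) / (6 * c * L\<^sup>2))"
      unfolding g_def using L c by (intro nn_integral_scaled_square) auto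
    finally show ?thesis .
  next
    case False
    \<comment> \<open>The proposal wraps around to \<open>(1 - t, 1)\<close>, where the barrier equals 1; this is no more than the
        quadratic would contribute on the unwrapped piece \<open>(- t, 0)\<close>.\<close>
    define t where "t = c - x"
    have t: "0 \<le> t" and a: "L \<le> a"
      using False by (auto simp: t_def a_def)
    have "?I \<le> (\<integral>\<^sup>+y. ennreal (g y) * indicator {0..x + c} y
        + ennreal (1 / (2 * c)) * indicator {1 - t..1} y \<partial>lborel)"
    proof (rule nn_integral_mono)
      fix y :: real
      have "y \<le> x + c \<or> 1 - t \<le> y" if "circ_dist x y < c"
        using that by (auto simp: circ_dist_def t_def)
      then consider "y \<in> {0..<1}" "circ_dist x y < c" "y \<in> {0..x + c}"
        | "y \<in> {0..<1}" "circ_dist x y < c" "y \<in> {1 - t..1}"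
        | "y \<notin> {0..<1} \<or> \<not> circ_dist x y < c"
        by fastforce
      then show "ennreal (proposal_density c x y) * ennreal (barrier L y) * indicator {0..<1} y
        \<le> ennreal (g y) * indicator {0..x + c} y + ennreal (1 / (2 * c)) * indicator {1 - t..1} y"
      proof cases
        case 1
        have "ennreal (proposal_density c x y) * ennreal (barrier L y) * indicator {0..<1} y \<le> ennreal (g y)"
          using 1 g[of y] c by (auto simp: proposal_density_def barrier_nonneg
              simp flip: ennreal_mult intro!: ennreal_leI)
        with 1 show ?thesis by (auto intro: order_trans)
      next
        case 2
        have "1 / (2 * c) * barrier L y \<le> 1 / (2 * c)"
          using mult_left_mono[OF barrier_le_1, of "1 / (2 * c)" L y] c by simp
        then have "ennreal (proposal_density c x y) * ennreal (barrier L y) * indicator {0..<1} y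
            \<le> ennreal (1 / (2 * c))"
          using 2 c by (auto simp: proposal_density_def barrier_nonneg
              simp flip: ennreal_mult intro!: ennreal_leI)
        with 2 show ?thesis by (auto intro: order_trans)
      qed (auto simp: proposal_density_def)
    qed
    also have "\<dots> = ennreal (((x + c - a) ^ 3 - (0 - a) ^ 3) / (6 * c * L\<^sup>2)) + ennreal (1 / (2 * c)) * ennreal t"
    proof -
      have "(\<integral>\<^sup>+y. ennreal (g y) * indicator {0..x + c} y \<partial>lborel)
          = ennreal (((x + c - a) ^ 3 - (0 - a) ^ 3) / (6 * c * L\<^sup>2))"
        unfolding g_def using x c L by (intro nn_integral_scaled_square) auto
      then show ?thesis
        using t by (subst nn_integral_add) (simp_all add: nn_integral_cmult_indicator)
    qed
    also have "\<dots> = ennreal (((x + c - a) ^ 3 - (0 - a) ^ 3) / (6 * c * L\<^sup>2) + t / (2 * c))"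
    proof -
      have "(0 - a) ^ 3 \<le> (x + c - a) ^ 3"
        using x c by (intro power_mono_odd) auto
      then show ?thesis
        using c t L by (simp flip: ennreal_mult ennreal_plus)
    qed
    also have "\<dots> \<le> ennreal (((x + c - a) ^ 3 - (x - c - a) ^ 3) / (6 * c * L\<^sup>2))"
    proof (rule ennreal_leI)
      \<comment> \<open>Since \<open>x - c - a = - (a + t)\<close>, expanding the cube produces a
        term \<open>3 * a\<^sup>2 * t\<close>. It is at least \<open>3 * L\<^sup>2 * t\<close>,
        which after division by \<open>6 * c * L\<^sup>2\<close> is the wrapped mass
        \<open>t / (2 * c)\<close>.\<close>
      have "L\<^sup>2 * t \<le> a\<^sup>2 * t"
        using L a t by (intro mult_right_mono power_mono) auto
      moreover have "0 \<le> 3 * a * t\<^sup>2 + t ^ 3"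
        using L a t by auto
      moreover have "(x - c - a) ^ 3 = - (a ^ 3 + 3 * a\<^sup>2 * t + 3 * a * t\<^sup>2 + t ^ 3)"
        unfolding t_def by algebra
      moreover have "(0 - a) ^ 3 = - (a ^ 3)"
        by algebra
      ultimately have "(x + c - a) ^ 3 - (0 - a) ^ 3 + 3 * L\<^sup>2 * t \<le> (x + c - a) ^ 3 - (x - c - a) ^ 3"
        by linarith
      then have "((x + c - a) ^ 3 - (0 - a) ^ 3 + 3 * L\<^sup>2 * t) / (6 * c * L\<^sup>2)
          \<le> ((x + c - a) ^ 3 - (x - c - a) ^ 3) / (6 * c * L\<^sup>2)"
        using L c by (intro divide_right_mono) auto
      then show "((x + c - a) ^ 3 - (0 - a) ^ 3) / (6 * c * L\<^sup>2) + t / (2 * c)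
          \<le> ((x + c - a) ^ 3 - (x - c - a) ^ 3) / (6 * c * L\<^sup>2)"
        using L c by (simp add: add_divide_distrib)
    qed
    finally show ?thesis .
  qed
  \<comment> \<open>With \<open>u = x - a\<close>, the difference of cubes is
    \<open>6 * u\<^sup>2 * c + 2 * c ^ 3\<close>.\<close>
  also have "((x + c - a) ^ 3 - (x - c - a) ^ 3) / (6 * c * L\<^sup>2) = barrier L x + c\<^sup>2 / (3 * L\<^sup>2)"
    unfolding bx using L c by (simp add: field_simps power2_eq_square power3_eq_cube)
  finally show ?thesis .
qed


section \<open>Drift of the barrier under one tempering step\<close>

lemma target_density_eq:
  "M > 0 \<Longrightarrow> x \<in> {0..1 / (2 * real M)} \<Longrightarrow> target_density M H x = 2 / (1 + exp H)"
proof -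
  assume M: "M > 0" and x: "x \<in> {0..1 / (2 * real M)}"
  then have "0 \<le> real M * x" "real M * x \<le> 1 / 2"
    by (auto simp: field_simps)
  then have "frac (real M * x) = real M * x"
    by (simp add: frac_eq)
  then show ?thesis
    using M x by (simp add: target_density_def)
qed

text \<open>Makes every point of the first cell a global minimum of the target density, so that
  moves from there are uphill.\<close>

lemma target_density_ge: "0 \<le> H \<Longrightarrow> 2 / (1 + exp H) \<le> target_density M H x"
  by (auto simp: target_density_def intro!: divide_right_mono add_pos_pos)

lemma pair_barrier_nonneg: "0 \<le> pair_barrier L z"
  by (simp add: pair_barrier_def barrier_nonneg)

lemma pair_barrier_le_1: "pair_barrier L z \<le> 1"
  by (simp add: pair_barrier_def)

lemma measurable_circle_borel: "f \<in> borel_measurable borel \<Longrightarrow> f \<in> borel_measurable circle"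
  unfolding circle_def by (intro measurable_restrict_space1) simp

lemma measurable_pair_barrier: "pair_barrier L \<in> borel_measurable (circle \<Otimes>\<^sub>M circle)"
proof -
  note measurable_circle_borel[OF measurable_barrier, measurable]
  show ?thesis unfolding pair_barrier_def[abs_def] by measurable
qed

lemma nn_integral_mh_kernel_barrier:
  assumes [measurable]: "p \<in> borel_measurable borel"
    and L: "0 < L" "6 * L < 1" and c: "0 < c" "c \<le> 2 * L" and x: "barrier L x < 1"
    and p: "0 < p x" "\<And>y. y \<in> {0..<1} \<Longrightarrow> p x \<le> p y"
  shows "(\<integral>\<^sup>+y. ennreal (barrier L y) \<partial>mh_kernel (proposal_density c) p x)
       \<le> ennreal (barrier L x + c\<^sup>2 / (3 * L\<^sup>2))"
proof -
  note measurable_circle_borel[OF measurable_barrier, measurable]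
  have "x \<in> {0..<1}"
    using barrier_less_1D[OF L(1) x] L by auto
  then show ?thesis
    using assms by (subst nn_integral_mh_kernel_uphill) (auto intro!: nn_integral_proposal_barrier)
qed

lemma (in pair_prob_space) nn_integral_pair_add:
  assumes [measurable]: "f \<in> borel_measurable M1" "g \<in> borel_measurable M2"
  shows "(\<integral>\<^sup>+z. f (fst z) + g (snd z) \<partial>(M1 \<Otimes>\<^sub>M M2)) = (\<integral>\<^sup>+x. f x \<partial>M1) + (\<integral>\<^sup>+y. g y \<partial>M2)"
  by (subst M2.nn_integral_fst[symmetric])
     (simp_all add: nn_integral_add M1.emeasure_space_1 M2.emeasure_space_1)

text \<open>A swap step never changes the symmetric barrier. In a move step each coordinate
  contributes at most one variance term, hence the factor 2. The mixture over the exchange coin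
  keeps the common bound.\<close>

lemma nn_integral_pt_kernel_barrier:
  assumes M: "M > 0" and H: "0 \<le> H" and L: "L = 1 / (8 * real M)" "6 * L < 1"
    and c: "0 < c" "c < 2 * L" and p: "0 < p_ee" "p_ee < 1"
    and x: "x \<in> space (circle \<Otimes>\<^sub>M circle)"
  shows "(\<integral>\<^sup>+z. ennreal (pair_barrier L z) \<partial>pt_kernel M H c p_ee x)
       \<le> ennreal (pair_barrier L x + 2 * (c\<^sup>2 / (3 * L\<^sup>2)))"
proof -
  let ?C = "circle \<Otimes>\<^sub>M circle" and ?\<kappa> = "c\<^sup>2 / (3 * L\<^sup>2)"
  let ?K0 = "mh_kernel (proposal_density c) (target_density M H)"
  let ?K1 = "mh_kernel (proposal_density c) (\<lambda>_. 1)"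
  have L0: "0 < L"
    using M L by simp
  have c': "c < 1 / 2"
    using c L by simp
  note [measurable] = measurable_pair_barrier measurable_circle_borel[OF measurable_barrier]
  have mh [measurable]: "?K0 \<in> circle \<rightarrow>\<^sub>M prob_algebra circle" "?K1 \<in> circle \<rightarrow>\<^sub>M prob_algebra circle"
    by (auto intro!: measurable_mh_kernel c c')
  obtain x0 x1 where x_eq: "x = (x0, x1)" and x01: "x0 \<in> space circle" "x1 \<in> space circle"
    using x by (auto simp: space_pair_measure)
  have K0: "?K0 x0 \<in> space (prob_algebra circle)" and K1: "?K1 x1 \<in> space (prob_algebra circle)"
    using mh x01 by (auto intro: measurable_space)
  then interpret K: pair_prob_space "?K0 x0" "?K1 x1"
    by (simp add: pair_prob_space_def pair_sigma_finite_def space_prob_algebra prob_space_imp_sigma_finite)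
  note [measurable_cong] = K0[unfolded space_prob_algebra, simplified, THEN conjunct1]
    K1[unfolded space_prob_algebra, simplified, THEN conjunct1]
  \<comment> \<open>This is the continuation bound to the exchange coin in \<open>pt_kernel\<close>.
    It must be shown to be a subprobability kernel before the integral can be taken through the
    bind.\<close>
  let ?exch = "\<lambda>exchange. if exchange then
       measure_pmf (bernoulli_pmf (swap_probability M H 1 0 (fst x) (snd x))) \<bind> (\<lambda>swap.
       return ?C (if swap then (snd x, fst x) else x))
     else ?K0 (fst x) \<Otimes>\<^sub>M ?K1 (snd x)"
  have swap': "(\<lambda>swap. return ?C (if swap then (snd x, fst x) else x)) \<in> measure_pmf b \<rightarrow>\<^sub>M prob_algebra ?C" for b
    using x by (auto simp: space_prob_algebra space_pair_measure intro!: prob_space_return)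
  note swap = measurable_prob_algebraD[OF swap']
  have swap_bind: "measure_pmf b \<bind> (\<lambda>swap. return ?C (if swap then (snd x, fst x) else x)) \<in> space (prob_algebra ?C)" for b
  proof -
    have b: "measure_pmf b \<in> space (prob_algebra (measure_pmf b))"
      by (simp add: space_prob_algebra measure_pmf.prob_space_axioms)
    show ?thesis
      using prob_space_bind'[OF b swap'] by (auto simp: space_prob_algebra x_eq sets_bind)
  qed
  have K_pair: "?K0 x0 \<Otimes>\<^sub>M ?K1 x1 \<in> space (prob_algebra ?C)"
    using K0 K1 K.P.prob_space_axioms by (auto simp: space_prob_algebra cong: sets_pair_measure_cong)
  have "?exch e \<in> space (prob_algebra ?C)" for e
    using swap_bind K_pair by (cases e) (simp_all add: x_eq)
  then have "?exch e \<in> space (subprob_algebra ?C)" for e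
    unfolding space_prob_algebra space_subprob_algebra by (blast intro: prob_space_imp_subprob_space)
  then have exch: "?exch \<in> measure_pmf b \<rightarrow>\<^sub>M subprob_algebra ?C" for b
    unfolding measurable_pmf_measure1 by (rule Pi_I)
  let ?I = "\<lambda>N. \<integral>\<^sup>+z. ennreal (pair_barrier L z) \<partial>N"
  have swap_le: "?I (?exch True) \<le> ennreal (pair_barrier L x + 2 * ?\<kappa>)"
  proof -
    have "?I (return ?C (if s then (snd x, fst x) else x)) = ennreal (pair_barrier L x)" for s
      using x by (subst nn_integral_return) (auto simp: pair_barrier_def space_pair_measure add.commute)
    then have "?I (?exch True) = ennreal (pair_barrier L x)"
      by (simp add: nn_integral_bind[OF _ swap] measure_pmf.emeasure_space_1 del: nn_integral_bernoulli_pmf)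
    then show ?thesis
      by (simp add: ennreal_leI)
  qed
  have move_le: "?I (?exch False) \<le> ennreal (pair_barrier L x + 2 * ?\<kappa>)"
  proof (cases "barrier L x0 + barrier L x1 < 1")
    case True
    then have lt1: "barrier L x0 < 1" "barrier L x1 < 1"
      using barrier_nonneg[of L x0] barrier_nonneg[of L x1] by linarith+
    then have "target_density M H x0 = 2 / (1 + exp H)"
      using barrier_less_1D[OF L0] M L by (intro target_density_eq) (auto intro: less_imp_le)
    moreover have "0 < 2 / (1 + exp H)"
      by (simp add: add_pos_pos)
    ultimately have 0: "(\<integral>\<^sup>+y. ennreal (barrier L y) \<partial>?K0 x0) \<le> ennreal (barrier L x0 + ?\<kappa>)"
      using target_density_ge[OF H, of M] lt1 L0 L c
      by (intro nn_integral_mh_kernel_barrier) auto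
    have 1: "(\<integral>\<^sup>+y. ennreal (barrier L y) \<partial>?K1 x1) \<le> ennreal (barrier L x1 + ?\<kappa>)"
      using lt1 L0 L c by (intro nn_integral_mh_kernel_barrier) auto
    have "?I (?exch False) \<le> (\<integral>\<^sup>+z. ennreal (barrier L (fst z)) + ennreal (barrier L (snd z)) \<partial>(?K0 x0 \<Otimes>\<^sub>M ?K1 x1))"
      unfolding x_eq pair_barrier_def
      by (auto intro!: nn_integral_mono ennreal_leI simp: barrier_nonneg simp flip: ennreal_plus)
    also have "\<dots> = (\<integral>\<^sup>+y. ennreal (barrier L y) \<partial>?K0 x0) + (\<integral>\<^sup>+y. ennreal (barrier L y) \<partial>?K1 x1)"
      by (rule K.nn_integral_pair_add) measurable
    also have "\<dots> \<le> ennreal (barrier L x0 + ?\<kappa>) + ennreal (barrier L x1 + ?\<kappa>)"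
      by (intro add_mono 0 1)
    also have "\<dots> = ennreal (pair_barrier L x + 2 * ?\<kappa>)"
      using True by (simp add: pair_barrier_def x_eq barrier_nonneg flip: ennreal_plus)
    finally show ?thesis .
  next
    case False
    \<comment> \<open>The barrier at \<open>x\<close> already has its maximal value 1.\<close>
    have "?I (?exch False) \<le> (\<integral>\<^sup>+z. 1 \<partial>(?K0 x0 \<Otimes>\<^sub>M ?K1 x1))"
      unfolding x_eq by (simp only: if_False fst_conv snd_conv, rule nn_integral_mono) (simp add: pair_barrier_le_1)
    also have "\<dots> = ennreal 1"
      by (simp add: K.P.emeasure_space_1)
    also have "\<dots> \<le> ennreal (pair_barrier L x + 2 * ?\<kappa>)"
      using False by (intro ennreal_leI) (simp add: pair_barrier_def x_eq)
    finally show ?thesis .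
  qed
  have "?I (pt_kernel M H c p_ee x) = (\<integral>\<^sup>+e. ?I (?exch e) \<partial>measure_pmf (bernoulli_pmf p_ee))"
    unfolding pt_kernel_def by (rule nn_integral_bind[OF _ exch]) measurable
  also have "\<dots> \<le> (\<integral>\<^sup>+e. ennreal (pair_barrier L x + 2 * ?\<kappa>) \<partial>measure_pmf (bernoulli_pmf p_ee))"
  proof (rule nn_integral_mono)
    fix e
    show "?I (?exch e) \<le> ennreal (pair_barrier L x + 2 * ?\<kappa>)"
      using swap_le move_le by (cases e) (simp_all only: if_True if_False)
  qed
  also have "\<dots> = ennreal (pair_barrier L x + 2 * ?\<kappa>)"
    by (simp add: measure_pmf.emeasure_space_1 del: nn_integral_bernoulli_pmf)
  finally show ?thesis .
qed

section \<open>Markov chains conditioned on an event of the past\<close>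

lemma sets_natural_filtrationI:
  assumes "A \<in> sets S"
  shows "X t -` A \<inter> space P \<in> sets (natural_filtration P S X t)"
  unfolding natural_filtration_def using assms by (subst sets_measure_of) auto

lemma subalgebra_natural_filtration:
  assumes "\<And>t. X t \<in> P \<rightarrow>\<^sub>M S"
  shows "subalgebra P (natural_filtration P S X t)"
proof -
  have "{X s -` A \<inter> space P | s A. s \<le> t \<and> A \<in> sets S} \<subseteq> sets P"
    using assms by (auto intro: measurable_sets)
  then have "sigma_sets (space P) {X s -` A \<inter> space P | s A. s \<le> t \<and> A \<in> sets S} \<subseteq> sets P"
    by (rule sets.sigma_sets_subset)
  then show ?thesis
    by (auto simp: subalgebra_def natural_filtration_def space_measure_of_conv sets_measure_of_conv)
qed

lemma sets_natural_filtration_mono: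
  assumes "s \<le> t"
  shows "sets (natural_filtration P S X s) \<subseteq> sets (natural_filtration P S X t)"
proof -
  have "{X r -` A \<inter> space P | r A. r \<le> s \<and> A \<in> sets S} \<subseteq> {X r -` A \<inter> space P | r A. r \<le> t \<and> A \<in> sets S}"
    using assms by force
  moreover have "{X r -` A \<inter> space P | r A. r \<le> n \<and> A \<in> sets S} \<subseteq> Pow (space P)" for n
    by auto
  ultimately show ?thesis
    unfolding natural_filtration_def by (simp add: sets_measure_of sigma_sets_mono')
qed

text \<open>Conditioning on an event known at time \<open>t\<close> leaves the transition out of
  time \<open>t\<close> unchanged: integrate the Markov property over \<open>E\<close> and divide by
  its probability.\<close>

lemma markov_chain_step_conditioned:
  assumes mc: "markov_chain P S K X" and E: "E \<in> sets (natural_filtration P S X t)" and pos: "measure P E > 0"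
  shows "distr (uniform_measure P E) S (X (Suc t)) = distr (uniform_measure P E) S (X t) \<bind> K"
proof -
  interpret prob_space P
    using mc by (simp add: markov_chain_def)
  have K [measurable]: "K \<in> S \<rightarrow>\<^sub>M prob_algebra S" and X [measurable]: "\<And>t. X t \<in> P \<rightarrow>\<^sub>M S"
    using mc by (auto simp: markov_chain_def)
  note sub = subalgebra_natural_filtration[where X=X and t=t and S=S, OF X]
  interpret F: finite_measure_subalgebra P "natural_filtration P S X t"
    by (intro finite_measure_subalgebra.intro finite_measure_subalgebra_axioms.intro finite_measure_axioms sub)
  have E' [measurable]: "E \<in> sets P"
    using E sub by (auto simp: subalgebra_def)
  have Q: "prob_space (uniform_measure P E)"
    using pos by (intro prob_space_uniform_measure) (auto simp: emeasure_eq_measure)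
  interpret D: prob_space "distr (uniform_measure P E) S (X t)"
    by (intro prob_space.prob_space_distr Q) simp
  have sets_K: "sets (K x) = sets S" if "x \<in> space S" for x
    using measurable_space[OF K that] by (simp add: space_prob_algebra)
  show ?thesis
  proof (rule measure_eqI)
    show "sets (distr (uniform_measure P E) S (X (Suc t))) = sets (distr (uniform_measure P E) S (X t) \<bind> K)"
      using D.not_empty by (subst sets_bind[where N=S]) (simp_all add: sets_K)
  next
    fix A assume "A \<in> sets (distr (uniform_measure P E) S (X (Suc t)))"
    then have A [measurable]: "A \<in> sets S" by simp
    have K1: "measure (K x) A \<le> 1" if "x \<in> space S" for x
      using measurable_space[OF K that] by (auto simp: space_prob_algebra intro: prob_space.prob_le_1)
    have meas [measurable]: "(\<lambda>x. measure (K x) A) \<in> borel_measurable S"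
      using K by (intro measure_measurable_subprob_algebra2[where N=S]) (auto intro: measurable_prob_algebraD)
    have "measure P (E \<inter> X (Suc t) -` A \<inter> space P) = (\<integral>\<omega>\<in>E. indicator A (X (Suc t) \<omega>) \<partial>P)"
      unfolding set_lebesgue_integral_def
      by (subst Bochner_Integration.integral_cong[OF refl, where g="indicator (E \<inter> X (Suc t) -` A \<inter> space P)"])
        (auto simp: Int_assoc split: split_indicator)
    \<comment> \<open>This is the defining property of conditional expectation, available because
      \<open>E\<close> lies in the filtration at time \<open>t\<close>.\<close>
    also have "\<dots> = (\<integral>\<omega>\<in>E. real_cond_exp P (natural_filtration P S X t) (\<lambda>\<omega>'. indicator A (X (Suc t) \<omega>')) \<omega> \<partial>P)"
      by (intro F.real_cond_exp_intA E integrable_const_bound[where B=1]) (auto split: split_indicator)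
    also have "\<dots> = (\<integral>\<omega>\<in>E. measure (K (X t \<omega>)) A \<partial>P)"
    proof (rule set_lebesgue_integral_cong_AE)
      have "AE \<omega> in P. real_cond_exp P (natural_filtration P S X t) (\<lambda>\<omega>'. indicator A (X (Suc t) \<omega>')) \<omega>
          = measure (K (X t \<omega>)) A"
        using mc A by (simp add: markov_chain_def)
      then show "AE \<omega>\<in>E in P. real_cond_exp P (natural_filtration P S X t)
          (\<lambda>\<omega>'. indicator A (X (Suc t) \<omega>')) \<omega> = measure (K (X t \<omega>)) A"
        by eventually_elim simp
    qed measurable
    finally have *: "ennreal (measure P (E \<inter> X (Suc t) -` A \<inter> space P)) = ennreal (\<integral>\<omega>\<in>E. measure (K (X t \<omega>)) A \<partial>P)"
      by simp
    also have "\<dots> = (\<integral>\<^sup>+\<omega>. ennreal (measure (K (X t \<omega>)) A) * indicator E \<omega> \<partial>P)"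
      unfolding set_lebesgue_integral_def using K1 measurable_space[OF X, of _ t]
      by (subst nn_integral_eq_integral[symmetric])
        (auto intro!: nn_integral_cong integrable_const_bound[where B=1] split: split_indicator)
    also have "\<dots> = (\<integral>\<^sup>+\<omega>. emeasure (K (X t \<omega>)) A * indicator E \<omega> \<partial>P)"
      using measurable_space[OF K measurable_space[OF X, of _ t]]
      by (intro nn_integral_cong)
        (auto simp: space_prob_algebra prob_space_def finite_measure.emeasure_eq_measure)
    finally have *: "emeasure P (E \<inter> X (Suc t) -` A \<inter> space P)
        = (\<integral>\<^sup>+\<omega>. emeasure (K (X t \<omega>)) A * indicator E \<omega> \<partial>P)"
      by (simp add: emeasure_eq_measure)
    have em: "(\<lambda>x. emeasure (K x) A) \<in> borel_measurable S"
      using measurable_prob_algebraD[OF K] A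
      by (rule measurable_compose[OF _ measurable_emeasure_subprob_algebra])
    have "emeasure (distr (uniform_measure P E) S (X (Suc t))) A
        = emeasure P (E \<inter> X (Suc t) -` A \<inter> space P) / emeasure P E"
      by (simp add: emeasure_distr Int_assoc)
    also have "\<dots> = (\<integral>\<^sup>+\<omega>. emeasure (K (X t \<omega>)) A \<partial>uniform_measure P E)"
    proof -
      from measurable_compose[OF X em] show ?thesis
        unfolding * by (rule nn_integral_uniform_measure[symmetric]) (rule E')
    qed
    also have "\<dots> = emeasure (distr (uniform_measure P E) S (X t) \<bind> K) A"
      using D.not_empty measurable_prob_algebraD[OF K] A em
      by (subst emeasure_bind[where N=S]) (simp_all add: nn_integral_distr)
    finally show "emeasure (distr (uniform_measure P E) S (X (Suc t))) A
        = emeasure (distr (uniform_measure P E) S (X t) \<bind> K) A" .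
  qed
qed

text \<open>The one-step bound is integrated against the conditioned law and iterated. Values in the
  extended nonnegative reals avoid integrability conditions on \<open>v\<close>.\<close>

lemma markov_chain_drift:
  assumes mc: "markov_chain P S K X" and E: "E \<in> sets (natural_filtration P S X T)" and pos: "measure P E > 0"
    and v [measurable]: "v \<in> borel_measurable S"
    and drift: "\<And>x. x \<in> space S \<Longrightarrow> (\<integral>\<^sup>+y. v y \<partial>K x) \<le> v x + \<kappa>"
  shows "(\<integral>\<^sup>+\<omega>. v (X (T + n) \<omega>) \<partial>uniform_measure P E)
       \<le> (\<integral>\<^sup>+\<omega>. v (X T \<omega>) \<partial>uniform_measure P E) + of_nat n * \<kappa>"
proof (induction n)
  case (Suc n)
  let ?Q = "uniform_measure P E"
  interpret P: prob_space P
    using mc by (simp add: markov_chain_def)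
  have K [measurable]: "K \<in> S \<rightarrow>\<^sub>M prob_algebra S" and X [measurable]: "\<And>t. X t \<in> P \<rightarrow>\<^sub>M S"
    using mc by (auto simp: markov_chain_def)
  interpret Q: prob_space ?Q
    using pos by (intro prob_space_uniform_measure) (auto simp: P.emeasure_eq_measure)
  have K': "K \<in> distr ?Q S (X (T + n)) \<rightarrow>\<^sub>M subprob_algebra S"
    using K by (simp add: measurable_prob_algebraD)
  \<comment> \<open>An event known at time \<open>T\<close> stays known later, so the conditioned
    step applies at every time from \<open>T\<close> on.\<close>
  have E': "E \<in> sets (natural_filtration P S X (T + n))"
    using E sets_natural_filtration_mono[of T "T + n"] by auto
  have "(\<integral>\<^sup>+\<omega>. v (X (T + Suc n) \<omega>) \<partial>?Q) = (\<integral>\<^sup>+y. v y \<partial>distr ?Q S (X (Suc (T + n))))"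
    by (simp add: nn_integral_distr)
  also have "\<dots> = (\<integral>\<^sup>+x. (\<integral>\<^sup>+y. v y \<partial>K x) \<partial>distr ?Q S (X (T + n)))"
    unfolding markov_chain_step_conditioned[OF mc E' pos] by (rule nn_integral_bind[OF v K'])
  also have "\<dots> \<le> (\<integral>\<^sup>+x. v x + \<kappa> \<partial>distr ?Q S (X (T + n)))"
    by (intro nn_integral_mono drift) simp
  also have "\<dots> = (\<integral>\<^sup>+\<omega>. v (X (T + n) \<omega>) + \<kappa> \<partial>?Q)"
    by (simp add: nn_integral_distr)
  also have "\<dots> = (\<integral>\<^sup>+\<omega>. v (X (T + n) \<omega>) \<partial>?Q) + \<kappa>"
    by (subst nn_integral_add) (auto simp: Q.emeasure_space_1[simplified])
  also have "\<dots> \<le> (\<integral>\<^sup>+\<omega>. v (X T \<omega>) \<partial>?Q) + of_nat n * \<kappa> + \<kappa>"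
    by (intro add_right_mono Suc.IH)
  finally show ?case
    by (simp add: algebra_simps)
qed simp


section \<open>The mean of the target distribution\<close>

text \<open>Here \<delta> is half a period, with density \<open>a\<close> on the first half and
  \<open>2 - a\<close> on the second. The factors \<open>4k + 1\<close> and \<open>4k + 3\<close>
  are differences of the consecutive squares of \<open>2k\<close>, \<open>2k + 1\<close> and
  \<open>2k + 2\<close>.\<close>

lemma has_integral_moment_period:
  fixes M k :: nat and H :: real
  assumes M: "M > 0"
  defines "a \<equiv> 2 / (1 + exp H)"
  defines "\<delta> \<equiv> 1 / (2 * real M)"
  shows "((\<lambda>x. x * target_density M H x) has_integral
      \<delta>\<^sup>2 * (a * (4 * real k + 1) + (2 - a) * (4 * real k + 3)) / 2) {2 * real k * \<delta>..2 * real (Suc k) * \<delta>}"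
proof -
  let ?l = "2 * real k * \<delta>" and ?m = "(2 * real k + 1) * \<delta>" and ?u = "2 * real (Suc k) * \<delta>"
  have \<delta>: "0 < \<delta>" "real M * \<delta> = 1 / 2"
    using M by (auto simp: \<delta>_def)
  have lin: "((\<lambda>x. x * d) has_integral d * (v\<^sup>2 - u\<^sup>2) / 2) {u..v}" if "u \<le> v" for d u v :: real
  proof -
    have "((\<lambda>x. x * d) has_integral d * v\<^sup>2 / 2 - d * u\<^sup>2 / 2) {u..v}"
      using that by (intro fundamental_theorem_of_calculus)
        (auto intro!: derivative_eq_intros simp: has_real_derivative_iff_has_vector_derivative[symmetric])
    then show ?thesis
      by (simp add: algebra_simps diff_divide_distrib)
  qed
  have b: "2 * exp H / (1 + exp H) = 2 - a"
    using exp_gt_zero[of H] by (simp add: a_def field_simps del: exp_gt_zero)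
  have frac: "frac (real M * x) / real M = x - ?l" if "x \<in> {?l..<?u}" for x
  proof -
    have "real k \<le> real M * x" "real M * x < real k + 1"
      using that M \<delta> by (auto simp: \<delta>_def field_simps)
    then have "\<lfloor>real M * x\<rfloor> = int k"
      by (simp add: floor_eq_iff)
    then show ?thesis
      using M by (simp add: frac_def \<delta>_def field_simps)
  qed
  have lo: "target_density M H x = a" if "x \<in> {?l..?m}" for x
  proof -
    have "x - ?l \<le> \<delta>" "x \<in> {?l..<?u}"
      using that \<delta>(1) by (auto simp: algebra_simps)
    then show ?thesis
      unfolding target_density_def by (simp only: frac flip: \<delta>_def a_def) simp
  qed
  have hi: "target_density M H x = 2 - a" if "x \<in> {?m<..<?u}" for x
  proof -
    have "\<not> x - ?l \<le> \<delta>" "x \<in> {?l..<?u}"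
      using that \<delta>(1) by (auto simp: algebra_simps)
    then show ?thesis
      unfolding target_density_def by (simp only: frac b flip: \<delta>_def a_def) simp
  qed
  have 1: "((\<lambda>x. x * target_density M H x) has_integral a * (?m\<^sup>2 - ?l\<^sup>2) / 2) {?l..?m}"
    using \<delta>(1) by (intro has_integral_eq[OF _ lin]) (auto simp: lo)
  \<comment> \<open>Both endpoints are exempted: the density is still \<open>a\<close> at the
    midpoint, and the next period starts at the right end.\<close>
  have 2: "((\<lambda>x. x * target_density M H x) has_integral (2 - a) * (?u\<^sup>2 - ?m\<^sup>2) / 2) {?m..?u}"
    using \<delta>(1) by (intro has_integral_spike_finite[OF _ _ lin, of "{?m, ?u}"]) (auto simp: hi)
  have "((\<lambda>x. x * target_density M H x) has_integral
      a * (?m\<^sup>2 - ?l\<^sup>2) / 2 + (2 - a) * (?u\<^sup>2 - ?m\<^sup>2) / 2) {?l..?u}"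
    using \<delta>(1) by (intro has_integral_combine[OF _ _ 1 2]) (auto intro!: mult_right_mono)
  also have "a * (?m\<^sup>2 - ?l\<^sup>2) / 2 + (2 - a) * (?u\<^sup>2 - ?m\<^sup>2) / 2
      = \<delta>\<^sup>2 * (a * (4 * real k + 1) + (2 - a) * (4 * real k + 3)) / 2"
    by (simp add: field_simps power2_eq_square)
  finally show ?thesis .
qed

text \<open>Summation over the \<open>M\<close> periods. The shift away from 1/2 reflects the
  different masses of the two halves of each period.\<close>

lemma target_mean_eq:
  assumes M: "M > 0"
  shows "target_mean M H = 1 / 2 + (1 - 2 / (1 + exp H)) / (4 * real M)"
proof -
  let ?a = "2 / (1 + exp H)" and ?\<delta> = "1 / (2 * real M)" and ?f = "\<lambda>x. x * target_density M H x"
  \<comment> \<open>Period \<open>k\<close> contributes \<open>4k + 3 - a\<close> in units of the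
    squared half period; summing over \<open>k < n\<close> gives this closed form.\<close>
  have "(?f has_integral ?\<delta>\<^sup>2 * (2 * real n ^ 2 + real n * (1 - ?a))) {0..2 * real n * ?\<delta>}" for n
  proof (induction n)
    case (Suc n)
    have *: "d * (2 * k\<^sup>2 + k * (1 - a)) + d * (a * (4 * k + 1) + (2 - a) * (4 * k + 3)) / 2
        = d * (2 * (1 + k)\<^sup>2 + (1 + k) * (1 - a))" for a d k :: real
      by (simp add: field_simps power2_eq_square)
    have "2 * real n * ?\<delta> \<le> 2 * real (Suc n) * ?\<delta>"
      by (intro mult_right_mono) auto
    then show ?case
      using has_integral_combine[OF _ _ Suc.IH has_integral_moment_period[OF M]]
      unfolding of_nat_Suc * by simp
  next
    case 0
    show ?case
      using has_integral_refl(2)[of ?f 0] by simp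
  qed
  from this[of M] have I: "(?f has_integral ?\<delta>\<^sup>2 * (2 * real M ^ 2 + real M * (1 - ?a))) {0..1}"
    using M by simp
  \<comment> \<open>Absolute integrability identifies the Lebesgue integral in
    \<open>target_mean\<close> with the gauge integral computed above.\<close>
  have "set_integrable lborel {0..1} ?f"
  proof -
    have "\<bar>target_density M H x\<bar> \<le> 2" for x
      using add_pos_pos[OF zero_less_one exp_gt_zero[of H]]
      by (auto simp: target_density_def divide_le_eq)
    then have "\<bar>?f x\<bar> \<le> 2" if "x \<in> {0..1}" for x
      using that mult_mono[of "\<bar>x\<bar>" 1 "\<bar>target_density M H x\<bar>" 2] by (simp add: abs_mult)
    then show ?thesis
      unfolding set_integrable_def
      by (intro integrableI_bounded_set_indicator[where B=2]) (auto intro!: AE_I2)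
  qed
  then have "target_mean M H = integral {0..1} ?f"
    unfolding target_mean_def by (rule set_borel_integral_eq_integral(2))
  also have "\<dots> = ?\<delta>\<^sup>2 * (2 * real M ^ 2 + real M * (1 - ?a))"
    using I by (rule integral_unique)
  also have "\<dots> = 1 / 2 + (1 - ?a) / (4 * real M)"
    using M by (simp add: field_simps power2_eq_square)
  finally show ?thesis .
qed

lemma target_mean_bounds:
  assumes "M > 0" "0 \<le> H"
  shows "1 / 2 \<le> target_mean M H" "target_mean M H \<le> 1 / 2 + 1 / (4 * real M)"
proof -
  have "2 / (1 + exp H) \<le> 1" "0 \<le> 2 / (1 + exp H)"
    using assms(2) by (auto simp: divide_le_eq add_pos_pos)
  then show "1 / 2 \<le> target_mean M H" "target_mean M H \<le> 1 / 2 + 1 / (4 * real M)"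
    using assms(1) by (auto simp: target_mean_eq intro!: divide_right_mono)
qed

section \<open>Numerical estimates\<close>

text \<open>The variable \<open>w\<close> stands for the barrier at the later time. The coefficient
  23/64 is the drop from the bound 5/64 inside the cell to the bound -18/64 = -9/32 outside.\<close>

lemma centered_product_ge:
  fixes x y m L :: real
  assumes L: "0 < L" "L \<le> 1 / 16" and x: "x \<in> {L..3 * L}" and y: "y \<in> {0..<1}"
    and m: "1 / 2 \<le> m" "m \<le> 1 / 2 + 2 * L"
    and w: "0 \<le> w" "4 * L < y \<Longrightarrow> w = 1"
  shows "5 / 64 - 23 / 64 * w \<le> (x - m) * (y - m)"
proof (cases "y \<le> 4 * L")
  case True
  \<comment> \<open>With \<open>L \<le> 1 / 16\<close>: \<open>m - x \<ge> 1/2 - 3/16\<close> and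
    \<open>m - y \<ge> 1/2 - 1/4\<close>.\<close>
  have "5 / 16 * (1 / 4) \<le> (m - x) * (m - y)"
    using True L x m by (intro mult_mono) auto
  then show ?thesis
    using w(1) by (simp add: algebra_simps)
next
  case False
  \<comment> \<open>Here \<open>m - x \<le> 1/2 + L \<le> 9/16\<close>, while
    \<open>y - m < 1/2\<close>.\<close>
  have "(m - x) * (y - m) \<le> 9 / 16 * (1 / 2)"
  proof (cases "m \<le> y")
    case True
    then show ?thesis
      using L x y m by (intro mult_mono) auto
  next
    case False
    then have "(m - x) * (y - m) \<le> 0"
      using L x m by (intro mult_nonneg_nonpos) auto
    then show ?thesis by simp
  qed
  then show ?thesis
    using False w(2) by (simp add: algebra_simps)
qed

text \<open>For \<open>r \<ge> 1/512\<close> the exponential is at least 1/2, so the left side is at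
  most -15/32, below the minimum -9/32 of the right side. For smaller \<open>r\<close>,
  \<open>w < 1/12\<close> keeps the right side above 1/32, and positivity of the exponential
  suffices.\<close>

lemma exp_tail_bound:
  fixes r w :: real
  assumes "0 < r" "w \<le> 1" "w \<le> 128 / 3 * r"
  shows "1 / 32 - exp (- 1 / (1024 * r)) \<le> 5 / 64 - 23 / 64 * w"
proof (cases "1 / 512 \<le> r")
  case True
  have "1 / 2 \<le> 1 + (- 1 / (1024 * r))"
    using True by (simp add: field_simps)
  also have "\<dots> \<le> exp (- 1 / (1024 * r))"
    by (rule exp_ge_add_one_self)
  finally show ?thesis
    using assms by simp
next
  case False
  moreover have "0 < exp (- 1 / (1024 * r))"
    by simp
  ultimately show ?thesis
    using assms by linarith
qed

section \<open>The conditional correlation bound\<close>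

theorem theorem5:
  fixes M T S :: nat and H c p_ee :: real
    and P :: "'a measure" and X :: "nat \<Rightarrow> 'a \<Rightarrow> real \<times> real" and E :: "'a set"
  assumes "M \<ge> 2" and "even M"
    and "H \<ge> 0"
    and "0 < c" and "c < 1 / (4 * real M)"
    and "0 < p_ee" and "p_ee < 1"
    and "T > 0" and "S > 0"
    and "markov_chain P (circle \<Otimes>\<^sub>M circle) (pt_kernel M H c p_ee) X"
    and "E = {\<omega> \<in> space P. fst (X T \<omega>) \<in> {1 / (8 * real M)..3 / (8 * real M)}
                         \<and> snd (X T \<omega>) \<in> {1 / (8 * real M)..3 / (8 * real M)}}"
    and "measure P E > 0"
  shows "(\<integral>\<omega>. (fst (X T \<omega>) - target_mean M H) * (fst (X (T + S) \<omega>) - target_mean M H)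
            \<partial>uniform_measure P E)
         \<ge> 1 / 32 - exp (- 1 / (1024 * (real M)\<^sup>2 * c\<^sup>2 * real S))"
proof -
  define L where "L = 1 / (8 * real M)"
  define m where "m = target_mean M H"
  let ?C = "circle \<Otimes>\<^sub>M circle" and ?Q = "uniform_measure P E" and ?v = "pair_barrier L"
  let ?W = "\<integral>\<omega>. ?v (X (T + S) \<omega>) \<partial>?Q"
  note mc = assms(10) and E_def = assms(11)
  have L: "0 < L" "L \<le> 1 / 16" and cL: "c < 2 * L"
    using assms(1,5) by (auto simp: L_def field_simps)
  have m: "1 / 2 \<le> m" "m \<le> 1 / 2 + 2 * L"
    using target_mean_bounds[of M H] assms(1,3) by (auto simp: m_def L_def)
  interpret P: prob_space P
    using mc by (simp add: markov_chain_def)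
  have X [measurable]: "X t \<in> P \<rightarrow>\<^sub>M ?C" for t
    using mc by (auto simp: markov_chain_def)
  note [measurable] = measurable_id_circle measurable_pair_barrier
  interpret Q: prob_space ?Q
    using assms(12) by (intro prob_space_uniform_measure) (auto simp: P.emeasure_eq_measure)
  have X_range: "fst (X t \<omega>) \<in> {0..<1}" if "\<omega> \<in> space P" for t \<omega>
    using measurable_space[OF X that, of t] by (auto simp: space_pair_measure)
  define B where "B = {z \<in> space ?C. fst z \<in> {L..3 * L} \<and> snd z \<in> {L..3 * L}}"
  have "B \<in> sets ?C"
    unfolding B_def by measurable
  moreover have E_eq: "E = X T -` B \<inter> space P"
    using measurable_space[OF X, of _ T] by (auto simp: E_def B_def L_def)
  \<comment> \<open>The event depends on \<open>X T\<close> alone, so it is known at time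
    \<open>T\<close> and the drift estimate may be conditioned on it.\<close>
  ultimately have E: "E \<in> sets (natural_filtration P ?C X T)"
    by (simp add: sets_natural_filtrationI)
  have E' [measurable]: "E \<in> sets P"
    unfolding E_eq using \<open>B \<in> sets ?C\<close> by measurable
  have AE_E: "AE \<omega> in ?Q. \<omega> \<in> E"
    by (rule AE_uniform_measureI) auto
  have int_v: "integrable ?Q (\<lambda>\<omega>. ?v (X (T + S) \<omega>))"
    by (intro Q.integrable_const_bound[where B=1])
      (auto simp: pair_barrier_nonneg pair_barrier_le_1)

  have "(\<integral>\<^sup>+\<omega>. ennreal (?v (X (T + S) \<omega>)) \<partial>?Q)
      \<le> (\<integral>\<^sup>+\<omega>. ennreal (?v (X T \<omega>)) \<partial>?Q) + of_nat S * ennreal (2 * (c\<^sup>2 / (3 * L\<^sup>2)))"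
  proof (rule markov_chain_drift[OF mc E assms(12)])
    fix x assume "x \<in> space ?C"
    then have "(\<integral>\<^sup>+z. ennreal (?v z) \<partial>pt_kernel M H c p_ee x) \<le> ennreal (?v x + 2 * (c\<^sup>2 / (3 * L\<^sup>2)))"
      using assms L cL by (intro nn_integral_pt_kernel_barrier) (auto simp: L_def)
    then show "(\<integral>\<^sup>+z. ennreal (?v z) \<partial>pt_kernel M H c p_ee x) \<le> ennreal (?v x) + ennreal (2 * (c\<^sup>2 / (3 * L\<^sup>2)))"
      by (simp add: pair_barrier_nonneg)
  qed measurable
  \<comment> \<open>On \<open>E\<close> both coordinates start in \<open>[L, 3L]\<close>, where the
    barrier vanishes; only the accumulated drift remains.\<close>
  also have "(\<integral>\<^sup>+\<omega>. ennreal (?v (X T \<omega>)) \<partial>?Q) = (\<integral>\<^sup>+\<omega>. 0 \<partial>?Q)"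
    using AE_E by (intro nn_integral_cong_AE) (auto simp: E_eq B_def pair_barrier_def barrier_eq_0)
  finally have "(\<integral>\<^sup>+\<omega>. ennreal (?v (X (T + S) \<omega>)) \<partial>?Q) \<le> ennreal (real S * (2 * (c\<^sup>2 / (3 * L\<^sup>2))))"
    by (simp add: ennreal_of_nat_eq_real_of_nat flip: ennreal_mult)
  then have "?W \<le> real S * (2 * (c\<^sup>2 / (3 * L\<^sup>2)))"
    using int_v by (subst (asm) nn_integral_eq_integral) (auto simp: pair_barrier_nonneg)
  also have "\<dots> = 128 / 3 * ((real M)\<^sup>2 * c\<^sup>2 * real S)"
    using assms(1) by (simp add: L_def field_simps power2_eq_square)
  finally have W: "?W \<le> 128 / 3 * ((real M)\<^sup>2 * c\<^sup>2 * real S)" .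
  have "?W \<le> (\<integral>\<omega>. 1 \<partial>?Q)"
    using int_v by (intro integral_mono) (auto simp: pair_barrier_le_1)
  then have W1: "?W \<le> 1"
    by (simp add: Q.prob_space[simplified])

  have "1 / 32 - exp (- 1 / (1024 * ((real M)\<^sup>2 * c\<^sup>2 * real S))) \<le> 5 / 64 - 23 / 64 * ?W"
    using assms(1,4,9) W W1 by (intro exp_tail_bound) auto
  also have "\<dots> = (\<integral>\<omega>. 5 / 64 - 23 / 64 * ?v (X (T + S) \<omega>) \<partial>?Q)"
    using int_v by (simp add: Q.prob_space[simplified])
  also have "\<dots> \<le> (\<integral>\<omega>. (fst (X T \<omega>) - m) * (fst (X (T + S) \<omega>) - m) \<partial>?Q)"
  proof (rule integral_mono_AE)
    show "integrable ?Q (\<lambda>\<omega>. 5 / 64 - 23 / 64 * ?v (X (T + S) \<omega>))"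
      using int_v by simp
    have "\<bar>(fst (X T \<omega>) - m) * (fst (X (T + S) \<omega>) - m)\<bar> \<le> 1 * 1" if "\<omega> \<in> space P" for \<omega>
      unfolding abs_mult using X_range[OF that, of T] X_range[OF that, of "T + S"] m L
      by (intro mult_mono) auto
    then show "integrable ?Q (\<lambda>\<omega>. (fst (X T \<omega>) - m) * (fst (X (T + S) \<omega>) - m))"
      by (intro Q.integrable_const_bound[where B=1]) auto
    show "AE \<omega> in ?Q. 5 / 64 - 23 / 64 * ?v (X (T + S) \<omega>) \<le> (fst (X T \<omega>) - m) * (fst (X (T + S) \<omega>) - m)"
      using AE_E
    proof eventually_elim
      case (elim \<omega>)
      \<comment> \<open>Beyond \<open>4 * L\<close> the first coordinate alone already has barrier
        1, and the truncated sum cannot exceed 1.\<close>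
      have "?v (X (T + S) \<omega>) = 1" if "4 * L < fst (X (T + S) \<omega>)"
        using that barrier_less_1D(2)[OF L(1), of "fst (X (T + S) \<omega>)"]
          barrier_nonneg[of L "snd (X (T + S) \<omega>)"]
        by (force simp: pair_barrier_def)
      then show ?case
        using elim X_range[of \<omega> "T + S"] L m
        by (intro centered_product_ge[where L=L]) (auto simp: E_eq B_def pair_barrier_nonneg)
    qed
  qed
  finally show ?thesis
    by (simp add: m_def mult.assoc)
qed

end
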